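(* Let $\mathcal X=\{x_1,\dots,x_n\}$ be a set of $n$ distinct elements with a partial order $\lesssim$, let $\gamma\ge 0$, and let $V$, $\widetilde E$, $E$, $G=(V,E)$, $\max(V)$, $\min(V)$, $\mathcal C$ and the bounded isotonic least squares estimator $\hat{\boldsymbol\theta}_\gamma(\mathbf y)$ be as defined in the context. Then the bounded isotonic constraint set $\mathcal C$ is a convex polyhedron of the form $\mathcal C=\{\boldsymbol\theta\in\mathbb{R}^n: B\boldsymbol\theta\le\mathbf c\}$, where $B\in\mathbb{R}^{|E|\times n}$ (rows indexed by the edge set $E$) is defined by $$B_{e,i}=\begin{cases}1 & \text{if } e=(i,j)\in E\text{ for some }j\ne i,\\ -1 & \text{if } e=(j,i)\in E\text{ for some }j\neq i,\\ 0 & \text{otherwise,}\end{cases}$$ and $\mathbf c=(c_e)_{e\in E}\in\mathbb{R}^{|E|}$ is defined by $c_e=\gamma$ if $e=(i,j)\in E$ with $i\in\max(V)$, $j\in\min(V)$, and $c_e=0$ otherwise. Let $B_e$ be the $e$-th row of $B$, let $J_{\mathbf y}:=\{e\in E: B_e\hat{\boldsymbol\theta}_\gamma(\mathbf y)=c_e\}$, and let $G_{J_{\mathbf y}}$ be the subgraph of $G$ (on the vertex set $V$) with edge set $J_{\mathbf y}$. Then for almost every $\mathbf y\in\mathbb{R}^n$ the divergence of $\hat{\boldsymbol\theta}_\gamma(\mathbf y)$ is the number of connected components of $G_{J_{\mathbf y}}$, i.e. $D(\mathbf y)=\omega(G_{J_{\mathbf y}})$, and therefore $\mathrm{df}(\hat{\boldsymbol\theta}_\gamma(\mathbf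 y))=\mathbb{E}[\omega(G_{J_{\mathbf y}})]$.
   Context: $V=\{1,\dots,n\}$ and $\widetilde E=\{(i,j): i\neq j,\ x_i\lesssim x_j\}$, so $(V,\widetilde E)$ is an acyclic directed graph. $\max(V)=\{i\in V:\text{there is no }j\text{ with }(i,j)\in\widetilde E\}$ and $\min(V)=\{i\in V:\text{there is no }j\text{ with }(j,i)\in\widetilde E\}$. $E:=\widetilde E\cup\{(i,j): i\in\max(V),\ j\in\min(V),\ i\ne j\}$ and $G=(V,E)$. The constraint set is $$\mathcal C=\{\boldsymbol\theta\in\mathbb{R}^n:\theta_i\le\theta_j\ \forall (i,j)\in\widetilde E,\ \ \theta_i\le\theta_j+\gamma\ \ \forall i\in\max(V),\, j\in\min(V),\, i\ne j\},$$ and $\hat{\boldsymbol\theta}_\gamma(\mathbf y):=\arg\min_{\boldsymbol\theta\in\mathcal C}\|\mathbf y-\boldsymbol\theta\|_2^2$. For a directed graph, $\omega$ denotes the number of connected components of its undirected version (isolated vertices count as components). The divergence is $D(\mathbf y):=\sum_{i=1}^n\frac{\partial}{\partial y_i}\hat\theta_{\gamma,i}(\mathbf y)$. For the degrees of freedom, $\mathbf y=\boldsymbol\theta^*+\boldsymbol\epsilon$ with $\boldsymbol\theta^*\in\mathbb{R}^n$ fixed, $\boldsymbol\epsilon\sim N(\mathbf 0,\sigma^2I_n)$, $\sigma>0$, and $\mathrm{df}(\hat{\boldsymbol\theta}_\gamma(\mathbf y)):=\frac1{\sigma^2}\sum_{i=1}^n\mathrm{Cov}(\hat\theta_{\gamma,i}(\mathbf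 y),y_i)$. Vector inequalities are componentwise. *)

theory Defs
  imports "HOL-Probability.Probability"
begin

text \<open>
  The vertex set \<open>V = {1, \<dots>, n}\<close> is the universe of a finite index type \<open>'n\<close>, so
  \<open>n = CARD('n)\<close> and \<open>\<real>\<^sup>n\<close> is \<open>real ^ 'n\<close>. A directed graph on \<open>V\<close> is given by its edge set.
\<close>

definition order_digraph :: "('n \<Rightarrow> 'a) \<Rightarrow> 'a rel \<Rightarrow> ('n \<times> 'n) set" where
  "order_digraph x r = {(i, j). i \<noteq> j \<and> (x i, x j) \<in> r}"

definition max_vertices :: "('n \<times> 'n) set \<Rightarrow> 'n set" where
  "max_vertices Et = {i. \<not> (\<exists>j. (i, j) \<in> Et)}"

definition min_vertices :: "('n \<times> 'n) set \<Rightarrow> 'n set" where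
  "min_vertices Et = {i. \<not> (\<exists>j. (j, i) \<in> Et)}"

definition bounded_edges :: "('n \<times> 'n) set \<Rightarrow> ('n \<times> 'n) set" where
  "bounded_edges Et = Et \<union> {(i, j). i \<in> max_vertices Et \<and> j \<in> min_vertices Et \<and> i \<noteq> j}"

definition bounded_isotonic_set :: "('n::finite \<times> 'n) set \<Rightarrow> real \<Rightarrow> (real ^ 'n) set" where
  "bounded_isotonic_set Et \<gamma> =
    {\<theta>. (\<forall>(i, j)\<in>Et. \<theta> $ i \<le> \<theta> $ j) \<and>
         (\<forall>i\<in>max_vertices Et. \<forall>j\<in>min_vertices Et. i \<noteq> j \<longrightarrow> \<theta> $ i \<le> \<theta> $ j + \<gamma>)}"

definition bounded_isotonic_lse ::
    "('n::finite \<times> 'n) set \<Rightarrow> real \<Rightarrow> real ^ 'n \<Rightarrow> real ^ 'n" where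
  "bounded_isotonic_lse Et \<gamma> y = arg_min_on (\<lambda>\<theta>. (norm (y - \<theta>))\<^sup>2) (bounded_isotonic_set Et \<gamma>)"

text \<open>
  The rows of \<open>B\<close> and the entries of \<open>c\<close> are indexed by the edges \<open>e \<in> E\<close>; row \<open>B\<^sub>e\<close> is a vector,
  so that \<open>(B \<theta>)\<^sub>e\<close> is the inner product \<open>B\<^sub>e \<bullet> \<theta>\<close>. Values at \<open>e \<notin> E\<close> are never used.
\<close>

definition constraint_row :: "('n::finite \<times> 'n) set \<Rightarrow> 'n \<times> 'n \<Rightarrow> real ^ 'n" where
  "constraint_row E e =
    (\<chi> i. if \<exists>j. j \<noteq> i \<and> e = (i, j) \<and> (i, j) \<in> E then 1
          else if \<exists>j. j \<noteq> i \<and> e = (j, i) \<and> (j, i) \<in> E then - 1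
          else 0)"

definition constraint_bound :: "('n \<times> 'n) set \<Rightarrow> real \<Rightarrow> 'n \<times> 'n \<Rightarrow> real" where
  "constraint_bound Et \<gamma> e =
    (if e \<in> bounded_edges Et \<and> fst e \<in> max_vertices Et \<and> snd e \<in> min_vertices Et then \<gamma> else 0)"

definition active_edges :: "('n::finite \<times> 'n) set \<Rightarrow> real \<Rightarrow> real ^ 'n \<Rightarrow> ('n \<times> 'n) set" where
  "active_edges Et \<gamma> y =
    {e \<in> bounded_edges Et.
       constraint_row (bounded_edges Et) e \<bullet> bounded_isotonic_lse Et \<gamma> y = constraint_bound Et \<gamma> e}"

text \<open>
  The connected components of the undirected version of \<open>(V, J)\<close> are the classes of the
  equivalence relation generated by \<open>J\<close> on all of \<open>V\<close>; an isolated vertex is a singleton class.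
\<close>

definition num_components :: "('n::finite \<times> 'n) set \<Rightarrow> nat" where
  "num_components J = card (UNIV // (J \<union> J\<inverse>)\<^sup>*)"

definition coord_line :: "(real ^ 'n \<Rightarrow> real ^ 'n) \<Rightarrow> real ^ 'n \<Rightarrow> 'n::finite \<Rightarrow> real \<Rightarrow> real" where
  "coord_line f y i = (\<lambda>t. f (\<chi> k. if k = i then t else y $ k) $ i)"

text \<open>
  The \<open>i\<close>-th summand below is the partial derivative of \<open>f\<^sub>i\<close> in the variable \<open>y\<^sub>i\<close> at \<open>y\<close>. As
  \<^const>\<open>deriv\<close> is total, existence of these derivatives has to be asserted separately.
\<close>

definition has_divergence :: "(real ^ 'n::finite \<Rightarrow> real ^ 'n) \<Rightarrow> real ^ 'n \<Rightarrow> bool" where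
  "has_divergence f y \<longleftrightarrow> (\<forall>i. coord_line f y i differentiable at (y $ i))"

definition divergence :: "(real ^ 'n::finite \<Rightarrow> real ^ 'n) \<Rightarrow> real ^ 'n \<Rightarrow> real" where
  "divergence f y = (\<Sum>i\<in>UNIV. deriv (coord_line f y i) (y $ i))"

text \<open>The density of \<open>N(0, \<sigma>\<^sup>2 I\<^sub>n)\<close>; note that \<^const>\<open>normal_density\<close> takes the standard deviation.\<close>

definition iso_normal_density :: "real \<Rightarrow> real ^ 'n::finite \<Rightarrow> real" where
  "iso_normal_density \<sigma> z = (\<Prod>i\<in>UNIV. normal_density 0 \<sigma> (z $ i))"

definition covariance :: "'w measure \<Rightarrow> ('w \<Rightarrow> real) \<Rightarrow> ('w \<Rightarrow> real) \<Rightarrow> real" where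
  "covariance M X Z =
    (\<integral>w. (X w - (\<integral>v. X v \<partial>M)) * (Z w - (\<integral>v. Z v \<partial>M)) \<partial>M)"

text \<open>Guards against the convention that a non-integrable function has integral \<open>0\<close>.\<close>

definition has_covariance :: "'w measure \<Rightarrow> ('w \<Rightarrow> real) \<Rightarrow> ('w \<Rightarrow> real) \<Rightarrow> bool" where
  "has_covariance M X Z \<longleftrightarrow>
    integrable M X \<and> integrable M Z \<and> integrable M (\<lambda>w. X w * Z w)"

definition degrees_of_freedom ::
    "'w measure \<Rightarrow> real \<Rightarrow> (real ^ 'n::finite \<Rightarrow> real ^ 'n) \<Rightarrow> ('w \<Rightarrow> real ^ 'n) \<Rightarrow> real" where
  "degrees_of_freedom M \<sigma> f Y =
    (1 / \<sigma>\<^sup>2) * (\<Sum>i\<in>UNIV. covariance M (\<lambda>w. f (Y w) $ i) (\<lambda>w. Y w $ i))"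

lemma bounded_isotonic_set_closed_convex:
  "closed (bounded_isotonic_set Et \<gamma>)" "convex (bounded_isotonic_set Et \<gamma>)"
proof -
  have eq: "bounded_isotonic_set Et \<gamma> =
     (\<Inter>(i, j)\<in>Et. {\<theta>. (axis i 1 - axis j 1) \<bullet> \<theta> \<le> 0}) \<inter>
     (\<Inter>(i, j)\<in>{(i, j). i \<in> max_vertices Et \<and> j \<in> min_vertices Et \<and> i \<noteq> j}.
        {\<theta>. (axis i 1 - axis j 1) \<bullet> \<theta> \<le> \<gamma>})"
    by (auto simp: bounded_isotonic_set_def inner_diff_left inner_axis' algebra_simps)
  show "closed (bounded_isotonic_set Et \<gamma>)"
    unfolding eq by (intro closed_Int closed_INT) (auto simp: closed_halfspace_le)
  show "convex (bounded_isotonic_set Et \<gamma>)"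
    unfolding eq by (intro convex_Int convex_INT) (auto simp: convex_halfspace_le)
qed

text \<open>The estimator is well defined: the minimiser exists and is unique.\<close>

lemma bounded_isotonic_lse_unique:
  assumes "\<gamma> \<ge> 0"
  shows "is_arg_min (\<lambda>\<theta>. (norm (y - \<theta>))\<^sup>2) (\<lambda>\<theta>. \<theta> \<in> bounded_isotonic_set Et \<gamma>) \<theta> \<longleftrightarrow>
         \<theta> = bounded_isotonic_lse Et \<gamma> y"
proof -
  let ?C = "bounded_isotonic_set Et \<gamma>"
  let ?M = "is_arg_min (\<lambda>\<theta>. (norm (y - \<theta>))\<^sup>2) (\<lambda>\<theta>. \<theta> \<in> ?C)"
  have "0 \<in> ?C"
    using assms by (auto simp: bounded_isotonic_set_def)
  then have ne: "?C \<noteq> {}"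
    by blast
  have iff: "?M z \<longleftrightarrow> z \<in> ?C \<and> (\<forall>u\<in>?C. dist y z \<le> dist y u)" for z
    by (auto simp: is_arg_min_linorder dist_norm)
  have M: "?M z \<longleftrightarrow> z = closest_point ?C y" for z
    unfolding iff
    using closest_point_unique[OF bounded_isotonic_set_closed_convex(2,1)]
      closest_point_exists[OF bounded_isotonic_set_closed_convex(1) ne] by metis
  have "bounded_isotonic_lse Et \<gamma> y = closest_point ?C y"
    unfolding bounded_isotonic_lse_def arg_min_on_def arg_min_def M by simp
  then show ?thesis
    using M by simp
qed

end

theory Submission
  imports Defs
begin

text \<open>
  The estimator is the metric projection onto a polyhedron \<open>{\<theta>. \<forall>e\<in>E. b e \<bullet> \<theta> \<le> c e}\<close>. Sort the points
  \<open>y\<close> by the set \<open>J\<close> of constraints that are active at their projection. The first-order condition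
  for the projection involves the active constraints only
  (\<open>closest_point_feasible_iff\<close>), and it has two consequences. Each stratum of constant \<open>J\<close> is
  convex, so its frontier is a Lebesgue null set; as there are finitely many strata, almost every
  point is interior to its own one. And within a stratum the projection acts on differences as
  the orthogonal projection onto \<open>{d. \<forall>e\<in>J. b e \<bullet> d = 0}\<close>.

  For the order constraints this subspace consists of the vectors that are constant on every
  connected component of \<open>(V, J)\<close>, and the orthogonal projection replaces each coordinate by its
  average over the component. Hence, at an interior point of a stratum, the \<open>i\<close>-th diagonal partial
  derivative is the reciprocal of the size of the component of \<open>i\<close>, and these reciprocals add up
  to the number of components.

  The formula for the degrees of freedom then is Stein's identity
  \<open>Cov (g \<epsilon>) (\<epsilon> $ i) = \<sigma>\<^sup>2 * E (\<partial>\<^sub>i g \<epsilon>)\<close> applied to every coordinate of the estimator, which is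
  nonexpansive. For a Lipschitz function that is partially differentiable almost everywhere, the
  identity follows without integration by parts (\<open>stein_lipschitz\<close>): by translation invariance of
  Lebesgue measure, a difference quotient of \<open>g\<close> integrated against the Gaussian density equals
  a difference quotient of the density integrated against \<open>g\<close>, and both sides converge by
  dominated convergence.
\<close>

section \<open>Projection onto a polyhedron\<close>

definition feasible :: "'e set \<Rightarrow> ('e \<Rightarrow> 'v::euclidean_space) \<Rightarrow> ('e \<Rightarrow> real) \<Rightarrow> 'v set" where
  "feasible E b c = {\<theta>. \<forall>e\<in>E. b e \<bullet> \<theta> \<le> c e}"

definition active_at :: "'e set \<Rightarrow> ('e \<Rightarrow> 'v::euclidean_space) \<Rightarrow> ('e \<Rightarrow> real) \<Rightarrow> 'v \<Rightarrow> 'e set" where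
  "active_at E b c \<theta> = {e\<in>E. b e \<bullet> \<theta> = c e}"

lemma polyhedron_feasible: "finite E \<Longrightarrow> polyhedron (feasible E b c)"
proof -
  assume "finite E"
  moreover have "feasible E b c = \<Inter>((\<lambda>e. {\<theta>. b e \<bullet> \<theta> \<le> c e}) ` E)"
    by (auto simp: feasible_def)
  ultimately show ?thesis
    by (auto intro!: polyhedron_Inter polyhedron_halfspace_le)
qed

text \<open>
  The variational inequality determines the projection: writing it for two candidate points, each
  tested against the other, and adding shows that their distance is zero.
\<close>

lemma closest_point_iff_dot:
  fixes S :: "'v::euclidean_space set"
  assumes "convex S" "closed S"
  shows "z \<in> S \<and> (\<forall>u\<in>S. (y - z) \<bullet> (u - z) \<le> 0) \<longleftrightarrow> S \<noteq> {} \<and> z = closest_point S y"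
proof
  assume z: "z \<in> S \<and> (\<forall>u\<in>S. (y - z) \<bullet> (u - z) \<le> 0)"
  let ?p = "closest_point S y"
  have ne: "S \<noteq> {}" using z by blast
  have "(y - z) \<bullet> (?p - z) \<le> 0" "(y - ?p) \<bullet> (z - ?p) \<le> 0"
    using z ne assms by (auto intro: closest_point_dot simp: closest_point_in_set)
  then have "(?p - z) \<bullet> (?p - z) \<le> 0"
    by (simp add: inner_diff_left inner_diff_right inner_commute)
  then have "(?p - z) \<bullet> (?p - z) = 0" by (intro antisym inner_ge_zero)
  then show "S \<noteq> {} \<and> z = ?p" using ne by simp
next
  assume "S \<noteq> {} \<and> z = closest_point S y"
  then show "z \<in> S \<and> (\<forall>u\<in>S. (y - z) \<bullet> (u - z) \<le> 0)"
    using assms by (auto intro: closest_point_dot simp: closest_point_in_set)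
qed

text \<open>
  Inactive constraints hold strictly, and there are finitely many of them, so a small step in any
  direction leaves them satisfied. A direction is therefore restricted by the active constraints only.
\<close>

lemma feasible_direction:
  assumes "finite E" "\<theta> \<in> feasible E b c" "\<And>e. e \<in> active_at E b c \<theta> \<Longrightarrow> b e \<bullet> d \<le> 0"
  obtains t where "t > 0" "\<theta> + t *\<^sub>R d \<in> feasible E b c"
proof -
  have "\<forall>\<^sub>F t in at_right 0. b e \<bullet> (\<theta> + t *\<^sub>R d) \<le> c e" if "e \<in> E" for e
  proof (cases "e \<in> active_at E b c \<theta>")
    case True
    then show ?thesis
      using assms(3)[OF True]
      by (auto simp: eventually_at_filter active_at_def inner_add_right mult_nonneg_nonpos)
  next
    case False
    then have "b e \<bullet> \<theta> < c e" using assms(2) that by (auto simp: active_at_def feasible_def)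
    moreover have "((\<lambda>t. b e \<bullet> (\<theta> + t *\<^sub>R d)) \<longlongrightarrow> b e \<bullet> (\<theta> + 0 *\<^sub>R d)) (at_right 0)"
      by (intro tendsto_intros)
    ultimately have "\<forall>\<^sub>F t in at_right 0. b e \<bullet> (\<theta> + t *\<^sub>R d) < c e"
      by (auto intro: order_tendstoD(2))
    then show ?thesis by (rule eventually_mono) simp
  qed
  then have "\<forall>\<^sub>F t in at_right 0. \<forall>e\<in>E. b e \<bullet> (\<theta> + t *\<^sub>R d) \<le> c e"
    using assms(1) by (simp add: eventually_ball_finite)
  moreover have "\<forall>\<^sub>F t in at_right 0. t > (0::real)"
    by (simp add: eventually_at_right_less)
  ultimately have "\<forall>\<^sub>F t in at_right 0. t > (0::real) \<and> \<theta> + t *\<^sub>R d \<in> feasible E b c"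
    by eventually_elim (auto simp: feasible_def)
  then obtain t where "t > 0 \<and> \<theta> + t *\<^sub>R d \<in> feasible E b c"
    using eventually_happens'[OF trivial_limit_at_right_real] by blast
  then show thesis using that by blast
qed

text \<open>
  The polar form of the Karush--Kuhn--Tucker conditions: the residual forms no acute angle with
  any direction of the tangent cone. What matters below is that this cone depends on \<open>\<theta>\<close> only
  through its active set, and that the condition is linear in the residual.
\<close>

lemma closest_point_feasible_iff:
  assumes "finite E"
  shows "feasible E b c \<noteq> {} \<and> \<theta> = closest_point (feasible E b c) y \<longleftrightarrow>
    \<theta> \<in> feasible E b c \<and>
    (\<forall>d. (\<forall>e\<in>active_at E b c \<theta>. b e \<bullet> d \<le> 0) \<longrightarrow> (y - \<theta>) \<bullet> d \<le> 0)" (is "?L \<longleftrightarrow> ?R")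
proof -
  have cc: "convex (feasible E b c)" "closed (feasible E b c)"
    using polyhedron_feasible[OF assms, of b c]
    by (auto simp: polyhedron_imp_convex polyhedron_imp_closed)
  have "?R \<longleftrightarrow> \<theta> \<in> feasible E b c \<and> (\<forall>u\<in>feasible E b c. (y - \<theta>) \<bullet> (u - \<theta>) \<le> 0)" (is "_ \<longleftrightarrow> ?R'")
  proof
    assume R: ?R
    have "b e \<bullet> (u - \<theta>) \<le> 0" if "u \<in> feasible E b c" "e \<in> active_at E b c \<theta>" for u e
      using that by (auto simp: feasible_def active_at_def inner_diff_right)
    with R show ?R' by blast
  next
    assume R: ?R'
    have "(y - \<theta>) \<bullet> d \<le> 0" if d: "\<forall>e\<in>active_at E b c \<theta>. b e \<bullet> d \<le> 0" for d
    proof -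
      obtain t where t: "t > 0" "\<theta> + t *\<^sub>R d \<in> feasible E b c"
        using feasible_direction[OF assms, of \<theta> b c d] R d by blast
      then have "(y - \<theta>) \<bullet> (t *\<^sub>R d) \<le> 0" using R by fastforce
      then show ?thesis using t by (simp add: mult_le_0_iff)
    qed
    with R show ?R by blast
  qed
  with closest_point_iff_dot[OF cc] show ?thesis by metis
qed

text \<open>
  For two points with active set \<open>J\<close>, the same convex combination of their projections is feasible and
  has active set \<open>J\<close> again, because strict inequalities stay strict. Its residual is the convex
  combination of the residuals, so it satisfies the optimality condition for the same cone and is
  the projection of the combined point.
\<close>

lemma convex_active_stratum:
  fixes b :: "'e \<Rightarrow> 'v::euclidean_space"
  assumes "finite E" "feasible E b c \<noteq> {}"
  shows "convex {y. active_at E b c (closest_point (feasible E b c) y) = J}"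
proof (rule convexI)
  let ?p = "closest_point (feasible E b c)"
  note iff = closest_point_feasible_iff[OF assms(1), of b c]
  fix y y' :: 'v and s t :: real
  assume y: "y \<in> {y. active_at E b c (?p y) = J}" and y': "y' \<in> {y. active_at E b c (?p y) = J}"
    and st: "0 \<le> s" "0 \<le> t" "s + t = 1"
  define \<theta> where "\<theta> = s *\<^sub>R ?p y + t *\<^sub>R ?p y'"
  have P: "?p y \<in> feasible E b c" "?p y' \<in> feasible E b c"
    using iff[of "?p y" y] iff[of "?p y'" y'] assms(2) by blast+
  have feas: "\<theta> \<in> feasible E b c"
    unfolding \<theta>_def
    using polyhedron_imp_convex[OF polyhedron_feasible[OF assms(1)]] P st by (rule convexD)
  have "b e \<bullet> \<theta> = c e \<longleftrightarrow> e \<in> J" if "e \<in> E" for e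
  proof -
    have E: "b e \<bullet> ?p y \<le> c e" "b e \<bullet> ?p y' \<le> c e"
      "b e \<bullet> ?p y = c e \<longleftrightarrow> e \<in> J" "b e \<bullet> ?p y' = c e \<longleftrightarrow> e \<in> J"
      using P that y y' by (auto simp: feasible_def active_at_def)
    have eq: "c e - b e \<bullet> \<theta> = s * (c e - b e \<bullet> ?p y) + t * (c e - b e \<bullet> ?p y')"
    proof -
      have "s * c e + t * c e = c e" using st by (metis distrib_right mult_1)
      then show ?thesis by (simp add: \<theta>_def inner_add_right algebra_simps)
    qed
    show ?thesis
    proof (cases "e \<in> J")
      case True
      then show ?thesis using eq E by simp
    next
      case False
      then have "c e - b e \<bullet> ?p y > 0" "c e - b e \<bullet> ?p y' > 0" using E by linarith+
      moreover have "s > 0 \<or> t > 0" using st by linarith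
      ultimately have "c e - b e \<bullet> \<theta> > 0"
        unfolding eq using st by (auto intro: add_pos_nonneg add_nonneg_pos)
      then show ?thesis using False by simp
    qed
  qed
  then have J: "active_at E b c \<theta> = J"
    using y by (auto simp: active_at_def)
  have "(s *\<^sub>R y + t *\<^sub>R y' - \<theta>) \<bullet> d \<le> 0" if "\<forall>e\<in>J. b e \<bullet> d \<le> 0" for d
  proof -
    have "(y - ?p y) \<bullet> d \<le> 0" "(y' - ?p y') \<bullet> d \<le> 0"
      using iff[of "?p y" y] iff[of "?p y'" y'] assms(2) that y y' by auto
    moreover have "(s *\<^sub>R y + t *\<^sub>R y' - \<theta>) \<bullet> d = s * ((y - ?p y) \<bullet> d) + t * ((y' - ?p y') \<bullet> d)"
      by (simp add: \<theta>_def inner_add_left inner_diff_left algebra_simps)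
    ultimately show ?thesis
      using st by (simp add: add_nonpos_nonpos mult_nonneg_nonpos)
  qed
  then have "\<theta> = ?p (s *\<^sub>R y + t *\<^sub>R y')"
    using iff[of \<theta> "s *\<^sub>R y + t *\<^sub>R y'"] feas J by blast
  then show "s *\<^sub>R y + t *\<^sub>R y' \<in> {y. active_at E b c (?p y) = J}"
    using J by simp
qed

text \<open>
  A point that is not interior to its stratum lies on the frontier of one of finitely many convex
  sets, and the frontier of a convex set is negligible.
\<close>

lemma AE_interior_active_stratum:
  assumes "finite E" "feasible E b c \<noteq> {}"
  shows "AE y in lborel. y \<in> interior {y'. active_at E b c (closest_point (feasible E b c) y') =
    active_at E b c (closest_point (feasible E b c) y)}"
proof -
  define S where "S J = {y. active_at E b c (closest_point (feasible E b c) y) = J}" for J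
  have "AE y in lborel. \<forall>J\<in>Pow E. y \<notin> frontier (S J)"
  proof (rule AE_finite_allI)
    fix J
    have "negligible (frontier (S J))"
      unfolding S_def by (rule negligible_convex_frontier[OF convex_active_stratum[OF assms]])
    then have "frontier (S J) \<in> null_sets lborel"
      by (simp add: negligible_iff_null_sets null_sets_completion_iff)
    then show "AE y in lborel. y \<notin> frontier (S J)" by (rule AE_not_in)
  qed (use assms in simp)
  then show ?thesis
  proof eventually_elim
    case (elim y)
    let ?J = "active_at E b c (closest_point (feasible E b c) y)"
    have "y \<in> S ?J" "?J \<in> Pow E" by (auto simp: S_def active_at_def)
    then have "y \<in> interior (S ?J)"
      using elim closure_subset[of "S ?J"] by (auto simp: frontier_def)
    then show ?case by (simp add: S_def)
  qed
qed

text \<open>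
  The two statements say that, between points with the same active constraints \<open>J\<close>, the projection acts on the
  displacement as the orthogonal projection onto \<open>K = {d. \<forall>e\<in>J. b e \<bullet> d = 0}\<close>: its increment lies in
  \<open>K\<close>, and differs from the displacement by a vector orthogonal to \<open>K\<close>.
\<close>

lemma closest_point_diff_active_stratum:
  assumes "finite E" "feasible E b c \<noteq> {}"
  defines "p \<equiv> closest_point (feasible E b c)"
  assumes "active_at E b c (p y') = active_at E b c (p y)"
  shows "e \<in> active_at E b c (p y) \<Longrightarrow> b e \<bullet> (p y' - p y) = 0"
    and "(\<And>e. e \<in> active_at E b c (p y) \<Longrightarrow> b e \<bullet> d = 0) \<Longrightarrow> (p y' - p y) \<bullet> d = (y' - y) \<bullet> d"
proof -
  show "b e \<bullet> (p y' - p y) = 0" if "e \<in> active_at E b c (p y)"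
    using that assms(4) by (auto simp: active_at_def inner_diff_right)
next
  assume d: "\<And>e. e \<in> active_at E b c (p y) \<Longrightarrow> b e \<bullet> d = 0"
  have "(z - p z) \<bullet> d = 0" if z: "active_at E b c (p z) = active_at E b c (p y)" for z
  proof -
    have "(z - p z) \<bullet> u \<le> 0" if "\<forall>e\<in>active_at E b c (p z). b e \<bullet> u \<le> 0" for u
      using closest_point_feasible_iff[OF assms(1), of b c "p z" z] assms(2) that
      unfolding p_def by blast
    \<comment> \<open>on the subspace both \<open>d\<close> and \<open>- d\<close> are tangent directions, so the inequality is an equation\<close>
    from this[of d] this[of "- d"] show ?thesis using d z by simp
  qed
  from this[of y] this[of y'] assms(4) show "(p y' - p y) \<bullet> d = (y' - y) \<bullet> d"
    by (simp add: inner_diff_left)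
qed

section \<open>Connected components\<close>

text \<open>
  The elements of one class contribute \<open>card C\<close> copies of \<open>1 / card C\<close>.
\<close>

lemma sum_inverse_card_class:
  fixes R :: "('n::finite \<times> 'n) set"
  assumes "equiv UNIV R"
  shows "(\<Sum>i\<in>UNIV. 1 / real (card (R `` {i}))) = real (card (UNIV // R))"
proof -
  have "(\<Sum>i\<in>UNIV. 1 / real (card (R `` {i}))) = (\<Sum>i\<in>\<Union>(UNIV // R). 1 / real (card (R `` {i})))"
    using Union_quotient[OF assms] by simp
  also have "\<dots> = (\<Sum>C\<in>UNIV // R. \<Sum>i\<in>C. 1 / real (card (R `` {i})))"
    using quotient_disj[OF assms] by (subst sum.Union_disjoint) auto
  also have "\<dots> = (\<Sum>C\<in>UNIV // R. 1)"
  proof (rule sum.cong[OF refl])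
    fix C assume C: "C \<in> UNIV // R"
    have "R `` {i} = C" if "i \<in> C" for i
      using C that assms by (auto simp: quotient_def equiv_class_eq_iff intro: equiv_class_eq)
    moreover have "card C > 0"
      using in_quotient_imp_non_empty[OF assms C] by (simp add: card_gt_0_iff)
    ultimately show "(\<Sum>i\<in>C. 1 / real (card (R `` {i}))) = 1" by (auto simp: card_gt_0_iff)
  qed
  finally show ?thesis by simp
qed

definition component :: "('n \<times> 'n) set \<Rightarrow> 'n \<Rightarrow> 'n set" where
  "component J i = (J \<union> J\<inverse>)\<^sup>* `` {i}"

lemma equiv_connectivity: "equiv UNIV ((J \<union> J\<inverse>)\<^sup>*)"
  by (intro equivI refl_rtrancl sym_rtrancl sym_Un_converse trans_rtrancl) auto

lemma sum_inverse_card_component: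
  fixes J :: "('n::finite \<times> 'n) set"
  shows "(\<Sum>i\<in>UNIV. 1 / real (card (component J i))) = real (num_components J)"
  unfolding component_def num_components_def by (rule sum_inverse_card_class[OF equiv_connectivity])

lemma self_in_component: "i \<in> component J i"
  by (simp add: component_def)

lemma component_nonempty: "component J i \<noteq> {}"
  using self_in_component[of i J] by auto

lemma edge_in_component_iff:
  assumes "(k, l) \<in> J" shows "k \<in> component J i \<longleftrightarrow> l \<in> component J i"
  using assms unfolding component_def by (auto intro: rtrancl_into_rtrancl)

lemma constant_on_component:
  assumes "\<And>k l. (k, l) \<in> J \<Longrightarrow> f k = f l" "k \<in> component J i"
  shows "f k = f i"
proof -
  have "(i, k) \<in> (J \<union> J\<inverse>)\<^sup>*" using assms(2) by (simp add: component_def)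
  then show ?thesis by induction (use assms(1) in auto)
qed


section \<open>The bounded isotonic estimator and its divergence\<close>

lemma constraint_row_inner:
  assumes "(i, j) \<in> E" "i \<noteq> j"
  shows "constraint_row E (i, j) \<bullet> \<theta> = \<theta> $ i - \<theta> $ j"
proof -
  have "constraint_row E (i, j) = axis i 1 - axis j 1"
    using assms by (auto simp: constraint_row_def vec_eq_iff axis_def)
  then show ?thesis by (simp add: inner_diff_left inner_axis')
qed

lemma bounded_edges_irrefl: "irrefl Et \<Longrightarrow> irrefl (bounded_edges Et)"
  by (auto simp: bounded_edges_def irrefl_def)

text \<open>
  No edge of \<open>Et\<close> starts in a maximal vertex, so the order edges and the edges from maximal to minimal
  vertices are disjoint, and \<open>constraint_bound\<close> gives the former \<open>0\<close> and the latter \<open>\<gamma>\<close>.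
\<close>

lemma bounded_isotonic_set_eq_feasible:
  fixes Et :: "('n::finite \<times> 'n) set"
  assumes "irrefl Et"
  shows "bounded_isotonic_set Et \<gamma> =
    feasible (bounded_edges Et) (constraint_row (bounded_edges Et)) (constraint_bound Et \<gamma>)"
proof (rule set_eqI)
  fix \<theta> :: "real ^ 'n"
  let ?E = "bounded_edges Et"
  let ?P = "\<lambda>e. constraint_row ?E e \<bullet> \<theta> \<le> constraint_bound Et \<gamma> e"
  have row: "constraint_row ?E (i, j) \<bullet> \<theta> = \<theta> $ i - \<theta> $ j" if "(i, j) \<in> ?E" for i j
    using that bounded_edges_irrefl[OF assms] by (intro constraint_row_inner) (auto simp: irrefl_def)
  have order: "?P (i, j) \<longleftrightarrow> \<theta> $ i \<le> \<theta> $ j" if "(i, j) \<in> Et" for i j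
  proof -
    have "constraint_bound Et \<gamma> (i, j) = 0"
      using that by (auto simp: constraint_bound_def max_vertices_def)
    then show ?thesis using row[of i j] that by (simp add: bounded_edges_def)
  qed
  have range: "?P (i, j) \<longleftrightarrow> \<theta> $ i \<le> \<theta> $ j + \<gamma>"
    if "i \<in> max_vertices Et" "j \<in> min_vertices Et" "i \<noteq> j" for i j
  proof -
    have "(i, j) \<in> ?E" using that by (simp add: bounded_edges_def)
    moreover from this have "constraint_bound Et \<gamma> (i, j) = \<gamma>"
      using that by (simp add: constraint_bound_def)
    ultimately show ?thesis using row[of i j] by auto
  qed
  have split: "(\<forall>e\<in>?E. Q e) \<longleftrightarrow> (\<forall>(i, j)\<in>Et. Q (i, j)) \<and>
      (\<forall>i\<in>max_vertices Et. \<forall>j\<in>min_vertices Et. i \<noteq> j \<longrightarrow> Q (i, j))" for Q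
    by (auto simp: bounded_edges_def)
  have "\<theta> \<in> feasible ?E (constraint_row ?E) (constraint_bound Et \<gamma>) \<longleftrightarrow>
      (\<forall>(i, j)\<in>Et. ?P (i, j)) \<and>
      (\<forall>i\<in>max_vertices Et. \<forall>j\<in>min_vertices Et. i \<noteq> j \<longrightarrow> ?P (i, j))"
    unfolding feasible_def mem_Collect_eq by (rule split)
  also have "\<dots> \<longleftrightarrow> \<theta> \<in> bounded_isotonic_set Et \<gamma>"
    unfolding bounded_isotonic_set_def mem_Collect_eq
    by (intro arg_cong2[where f="(\<and>)"] ball_cong refl) (auto simp: order range)
  finally show "\<theta> \<in> bounded_isotonic_set Et \<gamma> \<longleftrightarrow>
      \<theta> \<in> feasible ?E (constraint_row ?E) (constraint_bound Et \<gamma>)" by (rule sym)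
qed

lemma bounded_isotonic_set_nonempty: "\<gamma> \<ge> 0 \<Longrightarrow> bounded_isotonic_set Et \<gamma> \<noteq> {}"
proof -
  assume "\<gamma> \<ge> 0"
  then have "0 \<in> bounded_isotonic_set Et \<gamma>" by (auto simp: bounded_isotonic_set_def)
  then show ?thesis by blast
qed

lemma bounded_isotonic_lse_eq_closest_point:
  assumes "\<gamma> \<ge> 0"
  shows "bounded_isotonic_lse Et \<gamma> = closest_point (bounded_isotonic_set Et \<gamma>)"
proof
  fix y
  let ?C = "bounded_isotonic_set Et \<gamma>"
  have "is_arg_min (\<lambda>\<theta>. (norm (y - \<theta>))\<^sup>2) (\<lambda>\<theta>. \<theta> \<in> ?C) (closest_point ?C y)"
    using closest_point_exists[OF bounded_isotonic_set_closed_convex(1) bounded_isotonic_set_nonempty[OF assms], of Et y]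
    by (auto simp: is_arg_min_linorder dist_norm)
  then show "bounded_isotonic_lse Et \<gamma> y = closest_point ?C y"
    unfolding bounded_isotonic_lse_unique[OF assms] by (rule sym)
qed

text \<open>
  Projections onto closed convex sets are nonexpansive; this provides continuity and measurability
  of the estimator and the Lipschitz hypothesis of Stein's identity.
\<close>

lemma lipschitz_bounded_isotonic_lse:
  assumes "\<gamma> \<ge> 0"
  shows "1-lipschitz_on UNIV (bounded_isotonic_lse Et \<gamma>)"
  using closest_point_lipschitz[OF bounded_isotonic_set_closed_convex(2,1) bounded_isotonic_set_nonempty[OF assms]]
  by (auto intro!: lipschitz_onI simp: bounded_isotonic_lse_eq_closest_point[OF assms])

lemma active_edges_eq_active_at:
  assumes "irrefl Et" "\<gamma> \<ge> 0"
  defines "C \<equiv> feasible (bounded_edges Et) (constraint_row (bounded_edges Et)) (constraint_bound Et \<gamma>)"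
  shows "active_edges Et \<gamma> y =
    active_at (bounded_edges Et) (constraint_row (bounded_edges Et)) (constraint_bound Et \<gamma>) (closest_point C y)"
  unfolding active_edges_def active_at_def C_def
    bounded_isotonic_lse_eq_closest_point[OF assms(2)] bounded_isotonic_set_eq_feasible[OF assms(1)] ..

lemma AE_interior_active_edges:
  fixes Et :: "('n::finite \<times> 'n) set"
  assumes "irrefl Et" "\<gamma> \<ge> 0"
  shows "AE y in lborel. y \<in> interior {y'. active_edges Et \<gamma> y' = active_edges Et \<gamma> y}"
  unfolding active_edges_eq_active_at[OF assms]
  by (rule AE_interior_active_stratum)
     (use bounded_isotonic_set_nonempty[OF assms(2), of Et] in
       \<open>simp_all add: bounded_isotonic_set_eq_feasible[OF assms(1)]\<close>)

text \<open>
  A vector annihilated by the rows of the active edges is constant on components, and conversely the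
  indicator of a component is annihilated by them. Testing the orthogonality relation with this
  indicator identifies the increment of the estimator as the component average of the displacement.
\<close>

lemma bounded_isotonic_lse_diff:
  fixes Et :: "('n::finite \<times> 'n) set" and i :: 'n
  assumes "irrefl Et" "\<gamma> \<ge> 0" and same: "active_edges Et \<gamma> y' = active_edges Et \<gamma> y"
  defines "K \<equiv> component (active_edges Et \<gamma> y) i"
  shows "(bounded_isotonic_lse Et \<gamma> y' - bounded_isotonic_lse Et \<gamma> y) $ i =
    (\<Sum>k\<in>K. (y' - y) $ k) / real (card K)"
proof -
  let ?f = "bounded_isotonic_lse Et \<gamma>" and ?E = "bounded_edges Et" and ?J = "active_edges Et \<gamma> y"
  let ?d = "?f y' - ?f y"
  have row: "constraint_row ?E (k, l) \<bullet> \<theta> = \<theta> $ k - \<theta> $ l" if "(k, l) \<in> ?J" for k l and \<theta> :: "real ^ 'n"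
    using that bounded_edges_irrefl[OF assms(1)]
    by (intro constraint_row_inner) (auto simp: active_edges_def irrefl_def)
  have ne: "feasible ?E (constraint_row ?E) (constraint_bound Et \<gamma>) \<noteq> {}"
    using bounded_isotonic_set_nonempty[OF assms(2), of Et] bounded_isotonic_set_eq_feasible[OF assms(1), of \<gamma>]
    by simp
  note lse = bounded_isotonic_lse_eq_closest_point[OF assms(2), of Et]
    bounded_isotonic_set_eq_feasible[OF assms(1), of \<gamma>]
  note act = active_edges_eq_active_at[OF assms(1,2)]
  have diff: "constraint_row ?E e \<bullet> ?d = 0" if "e \<in> ?J" for e
    using closest_point_diff_active_stratum(1)[OF finite ne] same that unfolding lse act by blast
  have ortho: "?d \<bullet> v = (y' - y) \<bullet> v" if "\<And>e. e \<in> ?J \<Longrightarrow> constraint_row ?E e \<bullet> v = 0" for v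
    using closest_point_diff_active_stratum(2)[OF finite ne] same that unfolding lse act by blast
  have "?d $ k = ?d $ l" if "(k, l) \<in> ?J" for k l
    using diff[OF that] row[OF that, of ?d] by simp
  then have const: "?d $ k = ?d $ i" if "k \<in> K" for k
    using constant_on_component[of ?J "\<lambda>k. ?d $ k"] that unfolding K_def by blast
  define \<chi>K :: "real ^ 'n" where "\<chi>K = (\<chi> k. indicator K k)"
  have inner_K: "v \<bullet> \<chi>K = (\<Sum>k\<in>K. v $ k)" for v :: "real ^ 'n"
    by (simp add: inner_vec_def \<chi>K_def indicator_def if_distrib sum.If_cases cong: if_cong)
  have "constraint_row ?E e \<bullet> \<chi>K = 0" if "e \<in> ?J" for e
    using that row[of "fst e" "snd e" \<chi>K] edge_in_component_iff[of "fst e" "snd e" ?J i]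
    by (simp add: \<chi>K_def K_def indicator_def)
  then have "(\<Sum>k\<in>K. ?d $ k) = (\<Sum>k\<in>K. (y' - y) $ k)"
    using ortho[of \<chi>K] by (simp only: inner_K)
  moreover have "(\<Sum>k\<in>K. ?d $ k) = real (card K) * ?d $ i"
    using const by simp
  moreover have "card K > 0"
    by (simp add: K_def card_gt_0_iff component_nonempty)
  ultimately show ?thesis
    by (simp only: nonzero_eq_divide_eq mult.commute of_nat_eq_0_iff less_not_refl2 not_False_eq_True)
qed

lemma has_real_derivative_bounded_isotonic_lse:
  fixes Et :: "('n::finite \<times> 'n) set"
  assumes "irrefl Et" "\<gamma> \<ge> 0"
    and int: "y \<in> interior {y'. active_edges Et \<gamma> y' = active_edges Et \<gamma> y}"
  shows "((\<lambda>t. bounded_isotonic_lse Et \<gamma> (y + t *\<^sub>R axis i 1) $ i) has_real_derivative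
    1 / real (card (component (active_edges Et \<gamma> y) i))) (at 0)"
proof -
  let ?f = "bounded_isotonic_lse Et \<gamma>" and ?K = "component (active_edges Et \<gamma> y) i"
  have "((\<lambda>t. y + t *\<^sub>R axis i 1) \<longlongrightarrow> y + 0 *\<^sub>R axis i 1) (nhds (0::real))"
    by (intro tendsto_intros filterlim_ident)
  then have "\<forall>\<^sub>F t in nhds 0. y + t *\<^sub>R axis i (1::real) \<in> interior {y'. active_edges Et \<gamma> y' = active_edges Et \<gamma> y}"
    using int by (intro topological_tendstoD) auto
  then have ev: "\<forall>\<^sub>F t in nhds 0. ?f (y + t *\<^sub>R axis i 1) $ i = ?f y $ i + t / real (card ?K)"
  proof eventually_elim
    case (elim t)
    then have "active_edges Et \<gamma> (y + t *\<^sub>R axis i 1) = active_edges Et \<gamma> y"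
      using interior_subset by blast
    from bounded_isotonic_lse_diff[OF assms(1,2) this, of i]
    have "(?f (y + t *\<^sub>R axis i 1) - ?f y) $ i = (\<Sum>k\<in>?K. (t *\<^sub>R axis i 1) $ k) / real (card ?K)"
      by (simp only: add_diff_cancel_left')
    also have "(\<Sum>k\<in>?K. (t *\<^sub>R axis i 1) $ k) = (\<Sum>k\<in>?K. if k = i then t else 0)"
      by (intro sum.cong) (auto simp: axis_def)
    also have "\<dots> = t" by (simp add: self_in_component)
    finally show ?case by simp
  qed
  have "((\<lambda>t. ?f y $ i + t / real (card ?K)) has_real_derivative 1 / real (card ?K)) (at 0)"
    by (auto intro!: derivative_eq_intros simp: component_nonempty)
  then show ?thesis
    by (subst DERIV_cong_ev[OF refl ev refl])
qed

lemma coord_line_eq: "coord_line f y i t = f (y + (t - y $ i) *\<^sub>R axis i 1) $ i"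
  unfolding coord_line_def
  by (rule arg_cong[where f="\<lambda>v. f v $ i"]) (simp add: vec_eq_iff axis_def)

lemma divergence_bounded_isotonic_lse:
  fixes Et :: "('n::finite \<times> 'n) set"
  assumes "irrefl Et" "\<gamma> \<ge> 0"
    and int: "y \<in> interior {y'. active_edges Et \<gamma> y' = active_edges Et \<gamma> y}"
  shows "has_divergence (bounded_isotonic_lse Et \<gamma>) y"
    and "divergence (bounded_isotonic_lse Et \<gamma>) y = real (num_components (active_edges Et \<gamma> y))"
proof -
  have D: "(coord_line (bounded_isotonic_lse Et \<gamma>) y i has_real_derivative
      1 / real (card (component (active_edges Et \<gamma> y) i))) (at (y $ i))" for i
    using has_real_derivative_bounded_isotonic_lse[OF assms, of i]
      DERIV_shift[of "coord_line (bounded_isotonic_lse Et \<gamma>) y i" _ 0 "y $ i"]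
    by (simp add: coord_line_eq)
  show "has_divergence (bounded_isotonic_lse Et \<gamma>) y"
    unfolding has_divergence_def real_differentiable_def by (intro allI exI, rule D)
  show "divergence (bounded_isotonic_lse Et \<gamma>) y = real (num_components (active_edges Et \<gamma> y))"
    unfolding divergence_def DERIV_imp_deriv[OF D] by (rule sum_inverse_card_component)
qed

text \<open>
  The active set takes finitely many values, each on a set cut out by
  conditions on the continuous estimator.
\<close>

lemma borel_measurable_active_edges:
  fixes Et :: "('n::finite \<times> 'n) set" and F :: "('n \<times> 'n) set \<Rightarrow> real"
  assumes "\<gamma> \<ge> 0"
  shows "(\<lambda>y. F (active_edges Et \<gamma> y)) \<in> borel_measurable borel"
proof -
  have [measurable]: "bounded_isotonic_lse Et \<gamma> \<in> borel_measurable borel"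
    using lipschitz_on_continuous_on[OF lipschitz_bounded_isotonic_lse[OF assms]]
    by (rule borel_measurable_continuous_onI)
  have [measurable]: "{y. active_edges Et \<gamma> y = J} \<in> sets borel" for J
  proof -
    have "{y. active_edges Et \<gamma> y = J} = {y \<in> space borel. \<forall>e\<in>UNIV. e \<in> J \<longleftrightarrow> e \<in> bounded_edges Et \<and>
        constraint_row (bounded_edges Et) e \<bullet> bounded_isotonic_lse Et \<gamma> y = constraint_bound Et \<gamma> e}"
      by (auto simp: active_edges_def)
    also have "\<dots> \<in> sets borel"
      by (rule sets.sets_Collect_finite_All) (auto, measurable)
    finally show ?thesis .
  qed
  have "(\<lambda>y. F (active_edges Et \<gamma> y)) =
      (\<lambda>y. \<Sum>J\<in>UNIV. F J * indicator {y. active_edges Et \<gamma> y = J} y)"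
    by (simp add: indicator_def)
  also have "\<dots> \<in> borel_measurable borel" by measurable
  finally show ?thesis .
qed


section \<open>Stein's identity for Lipschitz functions\<close>

lemma iso_normal_density_nonneg: "0 \<le> iso_normal_density \<sigma> z"
  by (simp add: iso_normal_density_def prod_nonneg)

lemma measurable_iso_normal_density[measurable]: "iso_normal_density \<sigma> \<in> borel_measurable borel"
  unfolding iso_normal_density_def by measurable

lemma normal_density_times_exp:
  assumes "\<sigma> > 0"
  shows "normal_density 0 \<sigma> x * exp (a * x) = exp (a\<^sup>2 * \<sigma>\<^sup>2 / 2) * normal_density (a * \<sigma>\<^sup>2) \<sigma> x"
proof -
  have "- x\<^sup>2 / (2 * \<sigma>\<^sup>2) + a * x = a\<^sup>2 * \<sigma>\<^sup>2 / 2 - (x - a * \<sigma>\<^sup>2)\<^sup>2 / (2 * \<sigma>\<^sup>2)"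
    using assms by (simp add: field_simps power2_eq_square)
  then have "exp (- x\<^sup>2 / (2 * \<sigma>\<^sup>2)) * exp (a * x) =
      exp (a\<^sup>2 * \<sigma>\<^sup>2 / 2) * exp (- (x - a * \<sigma>\<^sup>2)\<^sup>2 / (2 * \<sigma>\<^sup>2))"
    by (simp flip: exp_add)
  then show ?thesis by (simp add: normal_density_def)
qed

lemma integrable_normal_density_exp_abs:
  assumes "\<sigma> > 0"
  shows "integrable lborel (\<lambda>x. normal_density 0 \<sigma> x * exp (c * \<bar>x\<bar>))"
proof (rule Bochner_Integration.integrable_bound)
  have "integrable lborel (\<lambda>x. normal_density 0 \<sigma> x * exp (a * x))" for a
    unfolding normal_density_times_exp[OF assms] using assms by simp
  from Bochner_Integration.integrable_add[OF this[of c] this[of "- c"]]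
  show "integrable lborel (\<lambda>x. normal_density 0 \<sigma> x * exp (c * x) + normal_density 0 \<sigma> x * exp (- c * x))" .
  show "AE x in lborel. norm (normal_density 0 \<sigma> x * exp (c * \<bar>x\<bar>)) \<le>
      norm (normal_density 0 \<sigma> x * exp (c * x) + normal_density 0 \<sigma> x * exp (- c * x))"
  proof (rule AE_I2)
    fix x
    have "exp (c * \<bar>x\<bar>) \<le> exp (c * x) + exp (- c * x)"
      by (cases "x \<ge> 0") simp_all
    then have "normal_density 0 \<sigma> x * exp (c * \<bar>x\<bar>) \<le> normal_density 0 \<sigma> x * (exp (c * x) + exp (- c * x))"
      by (intro mult_left_mono) simp_all
    then show "norm (normal_density 0 \<sigma> x * exp (c * \<bar>x\<bar>)) \<le>
        norm (normal_density 0 \<sigma> x * exp (c * x) + normal_density 0 \<sigma> x * exp (- c * x))"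
      by (simp add: distrib_left abs_mult add_nonneg_nonneg)
  qed
qed measurable

text \<open>
  Tonelli for coordinatewise products. The product formula for Lebesgue measure is indexed by basis
  vectors, hence the translation between \<open>Basis\<close> and the index type in the proof.
\<close>

lemma integrable_lborel_prod_coords:
  fixes f :: "'n::finite \<Rightarrow> real \<Rightarrow> real"
  assumes int: "\<And>k. integrable lborel (f k)" and nn: "\<And>k x. 0 \<le> f k x"
  shows "integrable lborel (\<lambda>z :: real ^ 'n. \<Prod>k\<in>UNIV. f k (z $ k))"
proof (rule integrableI_bounded)
  have [measurable]: "f k \<in> borel_measurable borel" for k
    using borel_measurable_integrable[OF int[of k]] by simp
  show "(\<lambda>z :: real ^ 'n. \<Prod>k\<in>UNIV. f k (z $ k)) \<in> borel_measurable lborel"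
    by measurable
  define g where "g b = f (THE k. b = axis k 1)" for b :: "real ^ 'n"
  have g: "g (axis k 1) = f k" for k
    unfolding g_def by (rule arg_cong[where f=f]) (auto simp: axis_eq_axis)
  have Basis: "(Basis :: (real ^ 'n) set) = range (\<lambda>k. axis k 1)"
    by (auto simp: Basis_vec_def)
  have "inj (\<lambda>k::'n. axis k (1::real))"
    by (auto simp: inj_def axis_eq_axis)
  then have prod_Basis: "(\<Prod>b\<in>Basis. h b) = (\<Prod>k\<in>UNIV. h (axis k 1))" for h :: "real ^ 'n \<Rightarrow> ennreal"
    unfolding Basis by (simp add: prod.reindex)
  have "(\<integral>\<^sup>+ z. ennreal (norm (\<Prod>k\<in>UNIV. f k (z $ k))) \<partial>(lborel :: (real ^ 'n) measure)) =
      (\<integral>\<^sup>+ z. (\<Prod>b\<in>Basis. ennreal (g b (z \<bullet> b))) \<partial>(lborel :: (real ^ 'n) measure))"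
    by (simp add: prod_Basis g inner_axis nn prod_nonneg prod_ennreal)
  also have "\<dots> = (\<Prod>b\<in>Basis. \<integral>\<^sup>+ x. ennreal (g b x) \<partial>lborel)"
    by (rule nn_integral_lborel_prod) (auto simp: g_def nn)
  also have "\<dots> = (\<Prod>k\<in>UNIV. ennreal (\<integral>x. f k x \<partial>lborel))"
    by (simp add: prod_Basis g nn_integral_eq_integral int nn)
  also have "\<dots> < \<infinity>"
    by (simp add: prod_ennreal nn)
  finally show "(\<integral>\<^sup>+ z. ennreal (norm (\<Prod>k\<in>UNIV. f k (z $ k))) \<partial>(lborel :: (real ^ 'n) measure)) < \<infinity>" .
qed

text \<open>
  The functions \<open>exp (c * (\<Sum>k. \<bar>z $ k\<bar>))\<close> serve as dominating functions for all Gaussian integrals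
  below. They factor over the coordinates, and they absorb both the linear growth of a
  Lipschitz function and the factor \<open>exp (h * z $ i / \<sigma>\<^sup>2)\<close> that a shift of the density by \<open>h\<close> produces.
\<close>

lemma integrable_iso_normal_density_exp_sum:
  fixes c :: real
  assumes "\<sigma> > 0"
  shows "integrable lborel (\<lambda>z :: real ^ 'n::finite. iso_normal_density \<sigma> z * exp (c * (\<Sum>k\<in>UNIV. \<bar>z $ k\<bar>)))"
proof -
  have "integrable lborel (\<lambda>z :: real ^ 'n. \<Prod>k\<in>UNIV. normal_density 0 \<sigma> (z $ k) * exp (c * \<bar>z $ k\<bar>))"
    by (rule integrable_lborel_prod_coords) (simp_all add: integrable_normal_density_exp_abs[OF assms])
  then show ?thesis
    by (simp add: iso_normal_density_def prod.distrib sum_distrib_left exp_sum)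
qed

lemma integrable_iso_normal_density_bound:
  fixes h :: "real ^ 'n::finite \<Rightarrow> real"
  assumes "\<sigma> > 0" and [measurable]: "h \<in> borel_measurable borel"
    and h: "\<And>z. \<bar>h z\<bar> \<le> A * exp (c * (\<Sum>k\<in>UNIV. \<bar>z $ k\<bar>))"
  shows "integrable lborel (\<lambda>z. iso_normal_density \<sigma> z * h z)"
proof (rule Bochner_Integration.integrable_bound)
  show "integrable lborel (\<lambda>z :: real ^ 'n. A * (iso_normal_density \<sigma> z * exp (c * (\<Sum>k\<in>UNIV. \<bar>z $ k\<bar>))))"
    using integrable_iso_normal_density_exp_sum[OF assms(1)] by (rule integrable_mult_right)
  have "\<bar>iso_normal_density \<sigma> z * h z\<bar> \<le>
      \<bar>A * (iso_normal_density \<sigma> z * exp (c * (\<Sum>k\<in>UNIV. \<bar>z $ k\<bar>)))\<bar>" for z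
    using mult_left_mono[OF order_trans[OF h[of z] abs_ge_self] iso_normal_density_nonneg[of \<sigma> z]]
    by (simp add: abs_mult iso_normal_density_nonneg mult_ac)
  then show "AE z in lborel. norm (iso_normal_density \<sigma> z * h z) \<le>
      norm (A * (iso_normal_density \<sigma> z * exp (c * (\<Sum>k\<in>UNIV. \<bar>z $ k\<bar>))))"
    by simp
qed measurable

lemma iso_normal_density_shift:
  fixes z :: "real ^ 'n::finite"
  assumes "\<sigma> > 0"
  shows "iso_normal_density \<sigma> (z - h *\<^sub>R axis i 1) =
    iso_normal_density \<sigma> z * exp ((2 * h * z $ i - h\<^sup>2) / (2 * \<sigma>\<^sup>2))"
proof -
  have "normal_density 0 \<sigma> (x - h) = normal_density 0 \<sigma> x * exp ((2 * h * x - h\<^sup>2) / (2 * \<sigma>\<^sup>2))" for x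
  proof -
    have "- (x - h)\<^sup>2 / (2 * \<sigma>\<^sup>2) = - x\<^sup>2 / (2 * \<sigma>\<^sup>2) + (2 * h * x - h\<^sup>2) / (2 * \<sigma>\<^sup>2)"
      by (simp add: power2_eq_square algebra_simps flip: add_divide_distrib)
    then have "exp (- (x - h)\<^sup>2 / (2 * \<sigma>\<^sup>2)) =
        exp (- x\<^sup>2 / (2 * \<sigma>\<^sup>2)) * exp ((2 * h * x - h\<^sup>2) / (2 * \<sigma>\<^sup>2))"
      by (simp only: exp_add)
    then show ?thesis by (simp add: normal_density_def)
  qed
  moreover have "(\<Prod>k\<in>UNIV - {i}. normal_density 0 \<sigma> ((z - h *\<^sub>R axis i 1) $ k)) =
      (\<Prod>k\<in>UNIV - {i}. normal_density 0 \<sigma> (z $ k))"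
    by (intro prod.cong) (auto simp: axis_def)
  ultimately show ?thesis
    by (simp add: iso_normal_density_def prod.remove[of UNIV i] mult_ac)
qed

lemma lborel_integral_translate:
  fixes f :: "'v::euclidean_space \<Rightarrow> real"
  assumes [measurable]: "f \<in> borel_measurable borel"
  shows "integrable lborel (\<lambda>z. f (v + z)) \<longleftrightarrow> integrable lborel f"
    and "(\<integral>z. f (v + z) \<partial>lborel) = (\<integral>z. f z \<partial>lborel)"
proof -
  show "integrable lborel (\<lambda>z. f (v + z)) \<longleftrightarrow> integrable lborel f"
    by (subst (2) lborel_distr_plus[of v, symmetric], subst integrable_distr_eq) auto
  show "(\<integral>z. f (v + z) \<partial>lborel) = (\<integral>z. f z \<partial>lborel)"
    by (subst (2) lborel_distr_plus[of v, symmetric], subst integral_distr) auto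
qed

lemma abs_exp_minus_one_le: "\<bar>exp u - 1\<bar> \<le> \<bar>u\<bar> * exp \<bar>u\<bar>" for u :: real
proof (cases "u \<ge> 0")
  case True
  have "exp u * (1 - u) \<le> exp u * exp (- u)"
    using exp_ge_add_one_self[of "- u"] by (intro mult_left_mono) auto
  then show ?thesis using True by (simp add: algebra_simps flip: exp_add)
next
  case False
  have "1 - exp u \<le> - u" using exp_ge_add_one_self[of u] by linarith
  also have "- u * 1 \<le> - u * exp (- u)" using False by (intro mult_left_mono) auto
  finally show ?thesis using False by simp
qed

lemma lipschitz_exp_growth:
  fixes g :: "real ^ 'n::finite \<Rightarrow> real"
  assumes "L-lipschitz_on UNIV g"
  shows "\<bar>g z\<bar> \<le> (\<bar>g 0\<bar> + L) * exp (\<Sum>k\<in>UNIV. \<bar>z $ k\<bar>)"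
proof -
  let ?s = "\<Sum>k\<in>UNIV. \<bar>z $ k\<bar>"
  have L: "0 \<le> L" using assms by (rule lipschitz_on_nonneg)
  have s: "0 \<le> ?s" by (simp add: sum_nonneg)
  have "\<bar>g z\<bar> \<le> \<bar>g 0\<bar> + L * norm z"
    using lipschitz_onD[OF assms, of z 0] by (simp add: dist_norm)
  also have "\<dots> \<le> \<bar>g 0\<bar> * exp ?s + L * exp ?s"
  proof (rule add_mono)
    show "\<bar>g 0\<bar> \<le> \<bar>g 0\<bar> * exp ?s" using s mult_left_mono[of 1 "exp ?s" "\<bar>g 0\<bar>"] by simp
    have "norm z \<le> ?s" by (rule norm_le_l1_cart)
    also have "?s \<le> exp ?s" using exp_ge_add_one_self[of ?s] by linarith
    finally show "L * norm z \<le> L * exp ?s" using L by (rule mult_left_mono)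
  qed
  finally show ?thesis by (simp add: algebra_simps)
qed

text \<open>
  With \<open>\<phi>\<close> the density, \<open>e\<close> the \<open>i\<close>-th unit vector and \<open>h > 0\<close>, the substitution \<open>z \<mapsto> z - h e\<close> gives
  \<open>\<integral> \<phi> z * (g (z + h e) - g z) / h = \<integral> (\<phi> (z - h e) - \<phi> z) / h * g z\<close>.
  As \<open>h\<close> tends to \<open>0\<close>, the left-hand integrand tends to \<open>\<phi> z * g' z\<close> and is dominated by \<open>\<phi> z * L\<close>,
  while the right-hand one tends to \<open>\<phi> z * (z $ i / \<sigma>\<^sup>2) * g z\<close>, dominated by \<open>\<phi>\<close> times an exponential.
\<close>

lemma stein_lipschitz:
  fixes g :: "real ^ 'n::finite \<Rightarrow> real"
  assumes \<sigma>: "\<sigma> > 0" and lip: "L-lipschitz_on UNIV g"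
    and g'[measurable]: "g' \<in> borel_measurable borel"
    and deriv: "AE z in lborel. ((\<lambda>t. g (z + t *\<^sub>R axis i 1)) has_real_derivative g' z) (at 0)"
  shows "integrable lborel (\<lambda>z. iso_normal_density \<sigma> z * g' z)"
    and "integrable lborel (\<lambda>z. iso_normal_density \<sigma> z * (g z * z $ i))"
    and "(\<integral>z. iso_normal_density \<sigma> z * (g z * z $ i) \<partial>lborel) =
      \<sigma>\<^sup>2 * (\<integral>z. iso_normal_density \<sigma> z * g' z \<partial>lborel)"
proof -
  let ?\<phi> = "iso_normal_density \<sigma> :: real ^ 'n \<Rightarrow> real" and ?e = "axis i 1 :: real ^ 'n"
  let ?s = "\<lambda>z :: real ^ 'n. \<Sum>k\<in>UNIV. \<bar>z $ k\<bar>"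
  note growth = lipschitz_exp_growth[OF lip]
  define A where "A = \<bar>g 0\<bar> + L"
  have A: "0 \<le> A" using lipschitz_on_nonneg[OF lip] by (simp add: A_def)
  have [measurable]: "g \<in> borel_measurable borel"
    using lipschitz_on_continuous_on[OF lip] by (rule borel_measurable_continuous_onI)
  have coord: "\<bar>z $ i\<bar> \<le> ?s z" for z
    by (rule member_le_sum) auto

  define h where "h n = 1 / real (Suc n)" for n
  have h: "0 < h n" "h n \<le> 1" for n by (simp_all add: h_def)
  have h0: "filterlim h (at 0) sequentially"
  proof -
    have "h \<longlonglongrightarrow> 0" unfolding h_def by (rule LIMSEQ_Suc[OF lim_1_over_n])
    then show ?thesis
      using h(1) by (auto simp: filterlim_at intro!: always_eventually less_imp_neq[symmetric])
  qed

  \<comment> \<open>difference quotients of \<open>g\<close>: bounded by the Lipschitz constant\<close>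
  define Q where "Q n z = ?\<phi> z * ((g (z + h n *\<^sub>R ?e) - g z) / h n)" for n z
  have Q_meas: "Q n \<in> borel_measurable lborel" for n unfolding Q_def by measurable
  have Q_lim: "AE z in lborel. (\<lambda>n. Q n z) \<longlonglongrightarrow> ?\<phi> z * g' z"
    using deriv
  proof eventually_elim
    case (elim z)
    then have "(\<lambda>t. (g (z + t *\<^sub>R ?e) - g z) / t) \<midarrow>0\<rightarrow> g' z"
      by (simp add: has_field_derivative_iff)
    from filterlim_compose[OF this h0] show ?case
      unfolding Q_def by (intro tendsto_mult tendsto_const)
  qed
  have Q_bound: "norm (Q n z) \<le> ?\<phi> z * L" for n z
  proof -
    have "\<bar>g (z + h n *\<^sub>R ?e) - g z\<bar> \<le> L * h n"
      using lipschitz_onD[OF lip, of "z + h n *\<^sub>R ?e" z] h(1)[of n] by (simp add: dist_norm)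
    then have "\<bar>(g (z + h n *\<^sub>R ?e) - g z) / h n\<bar> \<le> L"
      using h(1)[of n] by (simp add: field_simps)
    from mult_left_mono[OF this iso_normal_density_nonneg[of \<sigma> z]] show ?thesis
      by (simp add: Q_def abs_mult iso_normal_density_nonneg)
  qed
  have int_L: "integrable lborel (\<lambda>z. ?\<phi> z * L)"
    by (rule integrable_iso_normal_density_bound[OF \<sigma>, of _ "\<bar>L\<bar>" 0]) auto
  have phig'_meas: "(\<lambda>z. ?\<phi> z * g' z) \<in> borel_measurable lborel" by measurable
  note dcQ = phig'_meas Q_meas int_L Q_lim AE_I2[OF Q_bound]
  show "integrable lborel (\<lambda>z. ?\<phi> z * g' z)"
    by (rule integrable_dominated_convergence[OF dcQ])
  have limQ: "(\<lambda>n. \<integral>z. Q n z \<partial>lborel) \<longlonglongrightarrow> (\<integral>z. ?\<phi> z * g' z \<partial>lborel)"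
    by (rule integral_dominated_convergence[OF dcQ])

  \<comment> \<open>difference quotients of the density, written through \<open>u\<close>, the
     logarithm of the ratio of the shifted density to \<open>\<phi>\<close>\<close>
  define R where "R n z = (?\<phi> (z - h n *\<^sub>R ?e) - ?\<phi> z) / h n * g z" for n z
  define u where "u t z = (2 * t * z $ i - t\<^sup>2) / (2 * \<sigma>\<^sup>2)" for t and z :: "real ^ 'n"
  have R_eq: "R n z = ?\<phi> z * ((exp (u (h n) z) - 1) / h n) * g z" for n z
    unfolding R_def u_def iso_normal_density_shift[OF \<sigma>] by (simp add: algebra_simps)
  have R_meas: "R n \<in> borel_measurable lborel" for n unfolding R_def by measurable
  have R_lim: "(\<lambda>n. R n z) \<longlonglongrightarrow> ?\<phi> z * (z $ i / \<sigma>\<^sup>2) * g z" for z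
  proof -
    have "((\<lambda>t. exp (u t z)) has_real_derivative z $ i / \<sigma>\<^sup>2) (at 0)"
      unfolding u_def using \<sigma> by (auto intro!: derivative_eq_intros simp: field_simps)
    then have "(\<lambda>t. (exp (u t z) - 1) / t) \<midarrow>0\<rightarrow> z $ i / \<sigma>\<^sup>2"
      by (simp add: has_field_derivative_iff u_def)
    from filterlim_compose[OF this h0] show ?thesis
      unfolding R_eq by (intro tendsto_mult tendsto_const)
  qed
  define B where "B = A * exp (1 / \<sigma>\<^sup>2)"
  define W where "W z = ?\<phi> z * (B * exp ((2 / \<sigma>\<^sup>2 + 1) * ?s z))" for z
  have R_bound: "norm (R n z) \<le> W z" for n z
  proof -
    \<comment> \<open>\<open>v\<close> bounds \<open>\<bar>u\<bar> / h\<close> uniformly in \<open>0 < h \<le> 1\<close>\<close>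
    define v where "v = (2 * ?s z + 1) / (2 * \<sigma>\<^sup>2)"
    have s0: "0 \<le> ?s z" by (simp add: sum_nonneg)
    have v0: "0 \<le> v" using s0 by (simp add: v_def)
    have "\<bar>2 * z $ i - h n\<bar> \<le> 2 * ?s z + 1"
      using coord[of z] h[of n] by (auto simp: abs_le_iff)
    then have "\<bar>2 * z $ i - h n\<bar> / (2 * \<sigma>\<^sup>2) \<le> v"
      unfolding v_def by (intro divide_right_mono) auto
    then have "h n * (\<bar>2 * z $ i - h n\<bar> / (2 * \<sigma>\<^sup>2)) \<le> h n * v"
      using h(1)[of n] by (intro mult_left_mono) auto
    moreover have "u (h n) z = h n * ((2 * z $ i - h n) / (2 * \<sigma>\<^sup>2))"
      by (simp add: u_def power2_eq_square algebra_simps)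
    ultimately have u: "\<bar>u (h n) z\<bar> \<le> h n * v"
      using h(1)[of n] by (simp add: abs_mult)
    have hv: "h n * v \<le> v" using mult_right_mono[OF h(2)[of n] v0] by simp
    have "\<bar>exp (u (h n) z) - 1\<bar> \<le> \<bar>u (h n) z\<bar> * exp \<bar>u (h n) z\<bar>" by (rule abs_exp_minus_one_le)
    also have "\<dots> \<le> (h n * v) * exp v"
      using u hv v0 h(1)[of n] by (intro mult_mono) auto
    finally have "\<bar>(exp (u (h n) z) - 1) / h n\<bar> \<le> v * exp v"
      using h(1)[of n] by (simp add: field_simps)
    also have "\<dots> \<le> exp v * exp v"
      by (rule mult_right_mono) (use exp_ge_add_one_self[of v] in linarith, simp)
    also have "\<dots> = exp (1 / \<sigma>\<^sup>2 + 2 / \<sigma>\<^sup>2 * ?s z)"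
      using \<sigma> by (simp add: v_def field_simps flip: exp_add)
    finally have q: "\<bar>(exp (u (h n) z) - 1) / h n\<bar> \<le> exp (1 / \<sigma>\<^sup>2 + 2 / \<sigma>\<^sup>2 * ?s z)" .
    have "\<bar>(exp (u (h n) z) - 1) / h n\<bar> * \<bar>g z\<bar> \<le>
        exp (1 / \<sigma>\<^sup>2 + 2 / \<sigma>\<^sup>2 * ?s z) * (A * exp (?s z))"
      using q growth[of z] by (intro mult_mono) (auto simp: A_def)
    also have "\<dots> = B * exp ((2 / \<sigma>\<^sup>2 + 1) * ?s z)"
      by (simp add: B_def algebra_simps exp_add)
    finally show ?thesis
      using mult_left_mono[OF _ iso_normal_density_nonneg[of \<sigma> z]]
      unfolding R_eq W_def by (simp only: real_norm_def abs_mult mult.assoc abs_of_nonneg[OF iso_normal_density_nonneg])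
  qed
  have int_W: "integrable lborel W"
    unfolding W_def
    by (rule integrable_iso_normal_density_bound[OF \<sigma>, of _ B "2 / \<sigma>\<^sup>2 + 1"]) (auto simp: abs_mult B_def A)
  have lim_meas: "(\<lambda>z. ?\<phi> z * (z $ i / \<sigma>\<^sup>2) * g z) \<in> borel_measurable lborel" by measurable
  note dcR = lim_meas R_meas int_W AE_I2[OF R_lim] AE_I2[OF R_bound]
  have int_R: "integrable lborel (\<lambda>z. ?\<phi> z * (z $ i / \<sigma>\<^sup>2) * g z)"
    by (rule integrable_dominated_convergence[OF dcR])
  have limR: "(\<lambda>n. \<integral>z. R n z \<partial>lborel) \<longlonglongrightarrow> (\<integral>z. ?\<phi> z * (z $ i / \<sigma>\<^sup>2) * g z \<partial>lborel)"
    by (rule integral_dominated_convergence[OF dcR])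
  have eq: "?\<phi> z * (g z * z $ i) = \<sigma>\<^sup>2 * (?\<phi> z * (z $ i / \<sigma>\<^sup>2) * g z)" for z
    using \<sigma> by simp
  show "integrable lborel (\<lambda>z. ?\<phi> z * (g z * z $ i))"
    unfolding eq using int_R by (rule integrable_mult_right)

  \<comment> \<open>the translation step; each difference is split only after both of its terms are known to be integrable\<close>
  have "(\<integral>z. Q n z \<partial>lborel) = (\<integral>z. R n z \<partial>lborel)" for n
  proof -
    let ?F = "\<lambda>z. ?\<phi> (z - h n *\<^sub>R ?e) * g z"
    have g_int: "integrable lborel (\<lambda>z. ?\<phi> z * g z)"
      by (rule integrable_iso_normal_density_bound[OF \<sigma>, of _ A 1]) (use growth in \<open>auto simp: A_def\<close>)
    have F_shift: "?F (h n *\<^sub>R ?e + z) = ?\<phi> z * g (z + h n *\<^sub>R ?e)" for z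
      by (simp add: add.commute)
    have F_meas: "?F \<in> borel_measurable borel" by measurable
    have int_Q: "integrable lborel (Q n)"
      by (rule integrable_dominated_convergence2[OF dcQ])
    have F_split: "?\<phi> z * g (z + h n *\<^sub>R ?e) = h n * Q n z + ?\<phi> z * g z" for z
      using h(1)[of n] by (simp add: Q_def field_simps)
    have shift_int: "integrable lborel (\<lambda>z. ?\<phi> z * g (z + h n *\<^sub>R ?e))"
      unfolding F_split using int_Q g_int by simp
    have F_int: "integrable lborel ?F"
      using lborel_integral_translate(1)[OF F_meas, of "h n *\<^sub>R ?e"] shift_int unfolding F_shift by simp
    have "h n * (\<integral>z. Q n z \<partial>lborel) = (\<integral>z. ?\<phi> z * g (z + h n *\<^sub>R ?e) \<partial>lborel) - (\<integral>z. ?\<phi> z * g z \<partial>lborel)"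
      unfolding F_split using int_Q g_int by simp
    also have "(\<integral>z. ?\<phi> z * g (z + h n *\<^sub>R ?e) \<partial>lborel) = (\<integral>z. ?F z \<partial>lborel)"
      using lborel_integral_translate(2)[OF F_meas, of "h n *\<^sub>R ?e"] unfolding F_shift .
    also have "\<dots> - (\<integral>z. ?\<phi> z * g z \<partial>lborel) = (\<integral>z. ?F z - ?\<phi> z * g z \<partial>lborel)"
      using F_int g_int by simp
    also have "\<dots> = (\<integral>z. h n * R n z \<partial>lborel)"
      using h(1)[of n] by (intro Bochner_Integration.integral_cong) (auto simp: R_def field_simps)
    also have "\<dots> = h n * (\<integral>z. R n z \<partial>lborel)" by simp
    finally show ?thesis using h(1)[of n] by simp
  qed
  with limQ limR have "(\<integral>z. ?\<phi> z * g' z \<partial>lborel) = (\<integral>z. ?\<phi> z * (z $ i / \<sigma>\<^sup>2) * g z \<partial>lborel)"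
    using LIMSEQ_unique by simp
  then show "(\<integral>z. ?\<phi> z * (g z * z $ i) \<partial>lborel) = \<sigma>\<^sup>2 * (\<integral>z. ?\<phi> z * g' z \<partial>lborel)"
    unfolding eq by (simp only: integral_mult_right_zero)
qed

text \<open>
  The identity for \<open>g = 1\<close> says that the noise has mean zero, so the covariance is the
  expectation of \<open>g \<epsilon> * \<epsilon> $ i\<close>.
\<close>

lemma covariance_stein:
  fixes g g' :: "real ^ 'n::finite \<Rightarrow> real" and \<theta> :: real
  assumes "prob_space M" and \<sigma>: "\<sigma> > 0"
    and dens: "distributed M lborel \<epsilon> (\<lambda>z. ennreal (iso_normal_density \<sigma> z))"
    and lip: "L-lipschitz_on UNIV g" and g': "g' \<in> borel_measurable borel"
    and deriv: "AE z in lborel. ((\<lambda>t. g (z + t *\<^sub>R axis i 1)) has_real_derivative g' z) (at 0)"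
  shows "has_covariance M (\<lambda>w. g (\<epsilon> w)) (\<lambda>w. \<theta> + \<epsilon> w $ i)"
    and "integrable M (\<lambda>w. g' (\<epsilon> w))"
    and "covariance M (\<lambda>w. g (\<epsilon> w)) (\<lambda>w. \<theta> + \<epsilon> w $ i) = \<sigma>\<^sup>2 * (\<integral>w. g' (\<epsilon> w) \<partial>M)"
proof -
  interpret prob_space M by fact
  have [measurable]: "g \<in> borel_measurable borel"
    using lipschitz_on_continuous_on[OF lip] by (rule borel_measurable_continuous_onI)
  note [measurable] = g'
  have int: "integrable lborel (\<lambda>z. iso_normal_density \<sigma> z * h z) \<longleftrightarrow> integrable M (\<lambda>w. h (\<epsilon> w))"
    and expect: "(\<integral>z. iso_normal_density \<sigma> z * h z \<partial>lborel) = (\<integral>w. h (\<epsilon> w) \<partial>M)"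
    if "h \<in> borel_measurable borel" for h :: "real ^ 'n \<Rightarrow> real"
    using that by (auto intro!: distributed_integrable[OF dens] distributed_integral[OF dens]
        simp: iso_normal_density_nonneg)
  have meas: "(\<lambda>z. g z * z $ i) \<in> borel_measurable borel" "(\<lambda>z :: real ^ 'n. 1 * z $ i) \<in> borel_measurable borel"
    by measurable
  note S = stein_lipschitz[OF \<sigma> lip g' deriv]
  show int_g': "integrable M (\<lambda>w. g' (\<epsilon> w))"
    using S(1) int[OF g'] by simp
  have int_ge: "integrable M (\<lambda>w. g (\<epsilon> w) * \<epsilon> w $ i)"
    using S(2) int[OF meas(1)] by simp
  have E_ge: "(\<integral>w. g (\<epsilon> w) * \<epsilon> w $ i \<partial>M) = \<sigma>\<^sup>2 * (\<integral>w. g' (\<epsilon> w) \<partial>M)"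
    using S(3) expect[OF meas(1)] expect[OF g'] by simp
  have int_g: "integrable M (\<lambda>w. g (\<epsilon> w))"
    using integrable_iso_normal_density_bound[OF \<sigma>, of g "\<bar>g 0\<bar> + L" 1] lipschitz_exp_growth[OF lip] int[of g]
    by simp
  have const: "0-lipschitz_on UNIV (\<lambda>_ :: real ^ 'n. 1 :: real)" by (rule lipschitz_on_constant)
  have S1: "integrable lborel (\<lambda>z :: real ^ 'n. iso_normal_density \<sigma> z * (1 * z $ i))"
    "(\<integral>z. iso_normal_density \<sigma> z * (1 * z $ i) \<partial>(lborel :: (real ^ 'n) measure)) = 0"
    using stein_lipschitz(2,3)[OF \<sigma> const, of "\<lambda>_. 0" i] by simp_all
  have int_e: "integrable M (\<lambda>w. \<epsilon> w $ i)" and E_e: "(\<integral>w. \<epsilon> w $ i \<partial>M) = 0"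
    using S1 int[OF meas(2)] expect[OF meas(2)] by simp_all
  show "has_covariance M (\<lambda>w. g (\<epsilon> w)) (\<lambda>w. \<theta> + \<epsilon> w $ i)"
    unfolding has_covariance_def using int_g int_e int_ge by (simp add: distrib_left)
  have "covariance M (\<lambda>w. g (\<epsilon> w)) (\<lambda>w. \<theta> + \<epsilon> w $ i) =
      (\<integral>w. g (\<epsilon> w) * \<epsilon> w $ i - (\<integral>v. g (\<epsilon> v) \<partial>M) * \<epsilon> w $ i \<partial>M)"
    unfolding covariance_def using int_e E_e by (simp add: prob_space left_diff_distrib)
  also have "\<dots> = \<sigma>\<^sup>2 * (\<integral>w. g' (\<epsilon> w) \<partial>M)"
    using int_ge int_e E_ge E_e by simp
  finally show "covariance M (\<lambda>w. g (\<epsilon> w)) (\<lambda>w. \<theta> + \<epsilon> w $ i) = \<sigma>\<^sup>2 * (\<integral>w. g' (\<epsilon> w) \<partial>M)" .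
qed


section \<open>Degrees of freedom\<close>

text \<open>
  The almost sure partial derivatives of the estimator are reciprocal component sizes at
  \<open>\<theta>star + \<epsilon>\<close>; summing Stein's identity over the coordinates turns them into the number of components.
\<close>

lemma degrees_of_freedom_bounded_isotonic_lse:
  fixes Et :: "('n::finite \<times> 'n) set" and \<theta>star :: "real ^ 'n"
  assumes "irrefl Et" "\<gamma> \<ge> 0" and "prob_space M" "\<sigma> > 0"
    and dens: "distributed M lborel \<epsilon> (\<lambda>z. ennreal (iso_normal_density \<sigma> z))"
    and Y: "Y = (\<lambda>w. \<theta>star + \<epsilon> w)"
  shows "has_covariance M (\<lambda>w. bounded_isotonic_lse Et \<gamma> (Y w) $ i) (\<lambda>w. Y w $ i)"
    and "integrable M (\<lambda>w. real (num_components (active_edges Et \<gamma> (Y w))))"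
    and "degrees_of_freedom M \<sigma> (bounded_isotonic_lse Et \<gamma>) Y =
      (\<integral>w. real (num_components (active_edges Et \<gamma> (Y w))) \<partial>M)"
proof -
  let ?f = "bounded_isotonic_lse Et \<gamma>"
  define g where "g i z = ?f (\<theta>star + z) $ i" for i z
  define g' where "g' i z = 1 / real (card (component (active_edges Et \<gamma> (\<theta>star + z)) i))" for i z
  have lip: "1-lipschitz_on UNIV (g i)" for i
  proof (rule lipschitz_onI)
    fix z z' :: "real ^ 'n"
    have "dist (g i z) (g i z') \<le> dist (?f (\<theta>star + z)) (?f (\<theta>star + z'))"
      unfolding g_def by (rule dist_vec_nth_le)
    also have "\<dots> \<le> 1 * dist (\<theta>star + z) (\<theta>star + z')"
      by (rule lipschitz_onD[OF lipschitz_bounded_isotonic_lse[OF assms(2)]]) auto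
    finally show "dist (g i z) (g i z') \<le> 1 * dist z z'" by simp
  qed simp
  have meas: "g' i \<in> borel_measurable borel" for i
    unfolding g'_def
    by (rule measurable_compose[OF _ borel_measurable_active_edges[OF assms(2),
          of "\<lambda>J. 1 / real (card (component J i))"]]) measurable
  have deriv: "AE z in lborel. ((\<lambda>t. g i (z + t *\<^sub>R axis i 1)) has_real_derivative g' i z) (at 0)" for i
  proof -
    have "AE y in distr lborel borel ((+) \<theta>star). y \<in>
        interior {y'. active_edges Et \<gamma> y' = active_edges Et \<gamma> y}"
      unfolding lborel_distr_plus by (rule AE_interior_active_edges[OF assms(1,2)])
    then have "AE z in lborel. \<theta>star + z \<in>
        interior {y'. active_edges Et \<gamma> y' = active_edges Et \<gamma> (\<theta>star + z)}"
      by (rule AE_distrD[rotated]) simp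
    then show ?thesis
    proof eventually_elim
      case (elim z)
      from has_real_derivative_bounded_isotonic_lse[OF assms(1,2) this, of i]
      show ?case by (simp add: g_def g'_def add.assoc)
    qed
  qed
  note S = covariance_stein[OF assms(3,4) dens lip meas deriv]
  have fY: "(\<lambda>w. ?f (Y w) $ i) = (\<lambda>w. g i (\<epsilon> w))" for i by (simp add: Y g_def)
  have Yi: "(\<lambda>w. Y w $ i) = (\<lambda>w. \<theta>star $ i + \<epsilon> w $ i)" for i by (simp add: Y)
  show "has_covariance M (\<lambda>w. ?f (Y w) $ i) (\<lambda>w. Y w $ i)"
    unfolding fY Yi by (rule S(1))
  have comp: "real (num_components (active_edges Et \<gamma> (Y w))) = (\<Sum>i\<in>UNIV. g' i (\<epsilon> w))" for w
    unfolding g'_def Y by (rule sum_inverse_card_component[symmetric])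
  show "integrable M (\<lambda>w. real (num_components (active_edges Et \<gamma> (Y w))))"
    unfolding comp by (intro Bochner_Integration.integrable_sum S(2))
  show "degrees_of_freedom M \<sigma> ?f Y = (\<integral>w. real (num_components (active_edges Et \<gamma> (Y w))) \<partial>M)"
    unfolding degrees_of_freedom_def fY Yi comp S(3)
    using assms(4) by (simp add: Bochner_Integration.integral_sum S(2) flip: sum_distrib_left)
qed

theorem proposition5p2:
  fixes X :: "'a set" and r :: "'a rel" and x :: "'n::finite \<Rightarrow> 'a" and \<gamma> :: real
    and Et E :: "('n \<times> 'n) set"
  assumes "partial_order_on X r"
    and "bij_betw x UNIV X"
    and "\<gamma> \<ge> 0"
    and "Et = order_digraph x r"
    and "E = bounded_edges Et"
  shows "convex (bounded_isotonic_set Et \<gamma>) \<and> polyhedron (bounded_isotonic_set Et \<gamma>) \<and>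
    bounded_isotonic_set Et \<gamma> =
      {\<theta>. \<forall>e\<in>E. constraint_row E e \<bullet> \<theta> \<le> constraint_bound Et \<gamma> e} \<and>
    (AE y in lborel.
      has_divergence (bounded_isotonic_lse Et \<gamma>) y \<and>
      divergence (bounded_isotonic_lse Et \<gamma>) y = real (num_components (active_edges Et \<gamma> y))) \<and>
    (\<forall>(M :: 'w measure) (\<theta>star :: real ^ 'n) (\<sigma> :: real) (\<epsilon> :: 'w \<Rightarrow> real ^ 'n) (Y :: 'w \<Rightarrow> real ^ 'n).
      prob_space M \<longrightarrow> \<sigma> > 0 \<longrightarrow>
      distributed M lborel \<epsilon> (\<lambda>z. ennreal (iso_normal_density \<sigma> z)) \<longrightarrow>
      Y = (\<lambda>w. \<theta>star + \<epsilon> w) \<longrightarrow>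
        (\<forall>i. has_covariance M (\<lambda>w. bounded_isotonic_lse Et \<gamma> (Y w) $ i) (\<lambda>w. Y w $ i)) \<and>
        integrable M (\<lambda>w. real (num_components (active_edges Et \<gamma> (Y w)))) \<and>
        degrees_of_freedom M \<sigma> (bounded_isotonic_lse Et \<gamma>) Y =
          (\<integral>w. real (num_components (active_edges Et \<gamma> (Y w))) \<partial>M))"
proof -
  have irr: "irrefl Et"
    unfolding assms(4) order_digraph_def by (auto intro: irreflI)
  note \<gamma> = assms(3)
  note set_eq = bounded_isotonic_set_eq_feasible[OF irr, of \<gamma>]
  have "polyhedron (bounded_isotonic_set Et \<gamma>)"
    unfolding set_eq by (rule polyhedron_feasible) simp
  moreover have "bounded_isotonic_set Et \<gamma> =
      {\<theta>. \<forall>e\<in>E. constraint_row E e \<bullet> \<theta> \<le> constraint_bound Et \<gamma> e}"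
    unfolding set_eq feasible_def assms(5) ..
  moreover have "AE y in lborel. has_divergence (bounded_isotonic_lse Et \<gamma>) y \<and>
      divergence (bounded_isotonic_lse Et \<gamma>) y = real (num_components (active_edges Et \<gamma> y))"
    using AE_interior_active_edges[OF irr \<gamma>]
    by eventually_elim (intro conjI divergence_bounded_isotonic_lse[OF irr \<gamma>])
  ultimately show ?thesis
    by (intro conjI allI impI)
      (assumption | rule bounded_isotonic_set_closed_convex(2)
        degrees_of_freedom_bounded_isotonic_lse[OF irr \<gamma>])+
qed

end
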